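(* Let $(\alpha_n)$ be any sequence in $[0,\infty)$ converging to some $\alpha\in[0,\infty]$, let $\beta:=\sup_n\alpha_n$, and let $X\in\mathcal X_\beta$. Then for every $x\in\mathbb R$, $P_{\alpha_n}(X;x)\to P_\alpha(X;x)$ as $n\to\infty$.
   Context: For real $u$, $u_+:=\max(0,u)$ and $u_+^\alpha:=(u_+)^\alpha$. Define $h_\alpha:\mathbb R\to\mathbb R$ by $h_0(u)=\mathsf I\{u\ge0\}$ (indicator), $h_\alpha(u)=(1+u/\alpha)_+^\alpha$ for $0<\alpha<\infty$, and $h_\infty(u)=e^u$. For a random variable $X$, $x\in\mathbb R$ and $\alpha\in[0,\infty]$ put $P_\alpha(X;x):=\inf_{\lambda\in(0,\infty)}\mathsf E\,h_\alpha(\lambda(X-x))$; in particular $P_0(X;x)=\mathsf P(X\ge x)$. $\mathcal X_0$ is the set of all real-valued random variables (on a given probability space); for $\alpha\in(0,\infty)$, $\mathcal X_\alpha$ is the set of those $X$ with $\mathsf E X_+^\alpha<\infty$; $\mathcal X_\infty$ is the set of those $X$ with $\mathsf E e^{\lambda X}<\infty$ for some real $\lambda>0$. *)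

theory Defs
  imports "HOL-Probability.Probability"
begin

text \<open>
  The index \<open>\<alpha>\<close> ranges over \<open>[0, \<infinity>]\<close>, i.e. over the type \<^typ>\<open>ennreal\<close>, with its order topology.
  On nonnegative bases, \<^const>\<open>powr\<close> with a positive exponent is the usual power
  (in particular \<open>0 powr \<alpha> = 0\<close>).
\<close>

definition h_alpha :: "ennreal \<Rightarrow> real \<Rightarrow> real" where
  "h_alpha \<alpha> u =
    (if \<alpha> = 0 then (if u \<ge> 0 then 1 else 0)
     else if \<alpha> = \<infinity> then exp u
     else (max 0 (1 + u / enn2real \<alpha>)) powr (enn2real \<alpha>))"

text \<open>
  Expectations of nonnegative random variables may be infinite, so they are nonnegative
  integrals with values in \<^typ>\<open>ennreal\<close>; the infimum is taken there as well.
\<close>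

definition P_alpha :: "'a measure \<Rightarrow> ennreal \<Rightarrow> ('a \<Rightarrow> real) \<Rightarrow> real \<Rightarrow> ennreal" where
  "P_alpha M \<alpha> X x = (INF l\<in>{0<..}. \<integral>\<^sup>+ \<omega>. ennreal (h_alpha \<alpha> (l * (X \<omega> - x))) \<partial>M)"

definition X_alpha :: "'a measure \<Rightarrow> ennreal \<Rightarrow> ('a \<Rightarrow> real) set" where
  "X_alpha M \<alpha> =
    {X \<in> borel_measurable M.
      if \<alpha> = 0 then True
      else if \<alpha> = \<infinity> then (\<exists>l>0. (\<integral>\<^sup>+ \<omega>. ennreal (exp (l * X \<omega>)) \<partial>M) < \<infinity>)
      else (\<integral>\<^sup>+ \<omega>. ennreal ((max 0 (X \<omega>)) powr (enn2real \<alpha>)) \<partial>M) < \<infinity>}"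

lemma (in prob_space) P_alpha_0:
  assumes "X \<in> borel_measurable M"
  shows "P_alpha M 0 X x = ennreal (\<P>(\<omega> in M. X \<omega> \<ge> x))"
proof -
  have "(\<integral>\<^sup>+ \<omega>. ennreal (h_alpha 0 (l * (X \<omega> - x))) \<partial>M) = emeasure M {\<omega> \<in> space M. X \<omega> \<ge> x}"
    if "l > 0" for l :: real
  proof -
    have "(\<integral>\<^sup>+ \<omega>. ennreal (h_alpha 0 (l * (X \<omega> - x))) \<partial>M)
        = (\<integral>\<^sup>+ \<omega>. indicator {\<omega> \<in> space M. X \<omega> \<ge> x} \<omega> \<partial>M)"
      using that by (intro nn_integral_cong) (auto simp: h_alpha_def indicator_def zero_le_mult_iff)
    also have "\<dots> = emeasure M {\<omega> \<in> space M. X \<omega> \<ge> x}"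
      using assms by (intro nn_integral_indicator) measurable
    finally show ?thesis .
  qed
  then have "P_alpha M 0 X x = (INF l\<in>{0::real<..}. emeasure M {\<omega> \<in> space M. X \<omega> \<ge> x})"
    unfolding P_alpha_def by (intro INF_cong) auto
  also have "\<dots> = emeasure M {\<omega> \<in> space M. X \<omega> \<ge> x}"
    by (rule INF_const) (simp add: greaterThan_non_empty)
  finally show ?thesis
    by (simp add: emeasure_eq_measure)
qed

end

theory Submission
  imports Defs
begin

text \<open>
  Both \<open>h\<^sub>\<alpha>\<close> and \<open>P\<^sub>\<alpha>\<close> increase with \<open>\<alpha>\<close>. For the upper bound, dominated convergence with
  dominating function \<open>h\<^sub>\<beta>\<close> applies at each fixed scale \<open>\<lambda>\<close>; when \<open>\<beta> = \<infinity>\<close>, also \<open>\<alpha> = \<infinity>\<close>, and only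
  scales with a finite expectation matter. The lower bound is monotonicity if \<open>\<alpha> = 0\<close>. Otherwise
  near-optimal scales \<open>\<lambda>\<^sub>n\<close> accumulate at some \<open>L \<in> [0, \<infinity>]\<close>, and Fatou's lemma bounds the limit of the
  expectations from below: by \<open>E h\<^sub>\<alpha>(L(X - x))\<close> if \<open>0 < L < \<infinity>\<close>; by \<open>1\<close> if \<open>L = 0\<close>; and, if
  \<open>L = \<infinity>\<close>, by \<open>\<infinity>\<close> when \<open>P(X > x) > 0\<close> and by \<open>P(X = x)\<close> otherwise. Each of these is at least
  \<open>P\<^sub>\<alpha>(X; x)\<close>.
\<close>

section \<open>Case formulas for \<open>h_alpha\<close>\<close>

lemma h_alpha_nonneg: "0 \<le> h_alpha a u"
  by (simp add: h_alpha_def)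

lemma h_alpha_at_0 [simp]: "h_alpha a 0 = 1"
  by (simp add: h_alpha_def)

lemma h_alpha_measurable [measurable]: "h_alpha a \<in> borel_measurable borel"
  unfolding h_alpha_def by measurable

lemma h_alpha_ennreal:
  assumes "0 < p"
  shows "h_alpha (ennreal p) u = max 0 (1 + u / p) powr p"
  using assms by (simp add: h_alpha_def)

lemma h_alpha_0: "h_alpha 0 u = (if u \<ge> 0 then 1 else 0)"
  by (simp add: h_alpha_def)

lemma h_alpha_top: "h_alpha top u = exp u"
  by (simp add: h_alpha_def)

lemma h_alpha_cases [case_names zero top real]:
  fixes a :: ennreal
  obtains "a = 0" | "a = top" | p where "a = ennreal p" "0 < p"
  by (cases a) (auto simp: less_le)

section \<open>Monotonicity of \<open>h_alpha\<close> in argument and index, and joint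
  continuity\<close>

lemma h_alpha_mono_arg:
  assumes "u \<le> v"
  shows "h_alpha a u \<le> h_alpha a v"
proof (cases a rule: h_alpha_cases)
  case (real p)
  then have "max 0 (1 + u / p) \<le> max 0 (1 + v / p)"
    using assms by (intro max.mono) (auto simp: divide_right_mono)
  with real show ?thesis
    by (simp add: h_alpha_ennreal powr_mono2)
qed (use assms in \<open>auto simp: h_alpha_0 h_alpha_top\<close>)

text \<open>Apply ln w \<le> w - 1 at w = 1 / (1 + t / p). The exponent on the left tends to t as p
  grows, so this is the lower half of a sandwich for the limit index infinity.\<close>

lemma exp_le_powr_one_plus:
  fixes t p :: real
  assumes "0 < p" "0 < 1 + t / p"
  shows "exp (t / (1 + t / p)) \<le> (1 + t / p) powr p"
proof -
  have "- ln (1 + t / p) = ln (1 / (1 + t / p))"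
    using assms by (simp add: ln_div)
  also have "\<dots> \<le> 1 / (1 + t / p) - 1"
    using assms by (intro ln_le_minus_one) auto
  also have "\<dots> = - ((t / p) / (1 + t / p))"
    using assms by (simp add: field_simps)
  finally have "p * ((t / p) / (1 + t / p)) \<le> p * ln (1 + t / p)"
    using assms by (intro mult_left_mono) auto
  then show ?thesis
    using assms by (simp add: powr_def)
qed

lemma max_one_plus_powr_le_exp:
  fixes t p :: real
  assumes "0 < p"
  shows "max 0 (1 + t / p) powr p \<le> exp t"
proof -
  have "max 0 (1 + t / p) powr p \<le> exp (t / p) powr p"
    using assms by (intro powr_mono2) (auto simp: exp_ge_add_one_self)
  also have "\<dots> = exp t"
    using assms by (simp add: powr_def)
  finally show ?thesis .
qed

lemma Bernoulli_inequality_powr: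
  fixes t r :: real
  assumes "1 \<le> r" "-1 < t"
  shows "1 + r * t \<le> (1 + t) powr r"
proof (cases "1 + r * t \<le> 0")
  case True
  then show ?thesis
    using powr_ge_zero[of "1 + t" r] by linarith
next
  case False
  define y z where "y = 1 + t" and "z = 1 + r * t"
  have yz: "0 < y" "0 < z" "z = 1 + r * (y - 1)"
    using assms False by (auto simp: y_def z_def)
  \<comment> \<open>The inequality ln w \<le> w - 1 is used at z / y and at 1 / y with weights 1 and
    r - 1. These weights make the right-hand sides cancel, while the logarithms add up to ln z - r *
    ln y.\<close>
  have "ln (z / y) + (r - 1) * ln (1 / y) \<le> (z / y - 1) + (r - 1) * (1 / y - 1)"
    using yz assms by (intro add_mono mult_left_mono ln_le_minus_one) auto
  also have "\<dots> = 0"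
    using yz(1) unfolding yz(3) by (simp add: field_simps)
  finally have "ln z \<le> r * ln y"
    using yz(1,2) by (simp add: ln_div algebra_simps)
  then have "exp (ln z) \<le> exp (r * ln y)"
    by simp
  then show ?thesis
    using yz(1,2) by (simp add: powr_def flip: y_def z_def)
qed

text \<open>For finite positive indices p \<le> q this is Bernoulli's inequality with exponent q / p
  at u / q, raised to the power p. Index 0 uses the value 1 at the origin and monotonicity in the
  argument; index infinity uses 1 + t \<le> exp t.\<close>

lemma h_alpha_mono:
  assumes "a \<le> b"
  shows "h_alpha a u \<le> h_alpha b u"
proof (cases a rule: h_alpha_cases)
  case zero
  have "1 \<le> h_alpha b u" if "u \<ge> 0"
    using h_alpha_mono_arg[OF that, of b] by simp
  with zero show ?thesis
    by (auto simp: h_alpha_0 h_alpha_nonneg)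
next
  case top
  with assms show ?thesis by (simp add: top_unique)
next
  case a: (real p)
  show ?thesis
  proof (cases b rule: h_alpha_cases)
    case zero
    with assms a show ?thesis by simp
  next
    case top
    with a show ?thesis
      by (simp add: h_alpha_ennreal h_alpha_top max_one_plus_powr_le_exp)
  next
    case b: (real q)
    with a assms have pq: "p \<le> q" by simp
    show ?thesis
    proof (cases "1 + u / p \<le> 0")
      case True
      then show ?thesis using a by (simp add: h_alpha_ennreal h_alpha_nonneg max_def)
    next
      case False
      then have "-1 < u / q"
        using a b pq by (simp add: field_simps)
      then have "1 + q / p * (u / q) \<le> (1 + u / q) powr (q / p)"
        using a b pq by (intro Bernoulli_inequality_powr) auto
      then have "1 + u / p \<le> (1 + u / q) powr (q / p)"
        using a b by simp
      then have "(1 + u / p) powr p \<le> ((1 + u / q) powr (q / p)) powr p"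
        using a False by (intro powr_mono2) auto
      also have "\<dots> = (1 + u / q) powr q"
        using a by (simp add: powr_powr)
      finally show ?thesis
        using a b False \<open>-1 < u / q\<close> by (simp add: h_alpha_ennreal max_def)
    qed
  qed
qed

text \<open>Index and argument move together because near-optimal scales vary with n. The limit
  index 0 is excluded: \<open>h_alpha 0\<close> jumps at 0, so joint continuity fails there.\<close>

lemma h_alpha_tendsto:
  assumes a: "(a \<longlongrightarrow> \<alpha>) F" and u: "(u \<longlongrightarrow> u0) F" and "\<alpha> \<noteq> 0"
  shows "((\<lambda>n. h_alpha (a n) (u n)) \<longlongrightarrow> h_alpha \<alpha> u0) F"
proof (cases \<alpha> rule: h_alpha_cases)
  case zero
  with assms show ?thesis by simp
next
  case (real p)
  define q where "q n = enn2real (a n)" for n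
  have q: "(q \<longlongrightarrow> p) F"
    unfolding q_def using a real by (intro tendsto_enn2real) auto
  have "\<forall>\<^sub>F n in F. a n < top"
    using a real by (intro order_tendstoD(2)) auto
  moreover have "\<forall>\<^sub>F n in F. 0 < q n"
    using q real by (intro order_tendstoD(1)) auto
  ultimately have ev: "\<forall>\<^sub>F n in F. max 0 (1 + u n / q n) powr q n = h_alpha (a n) (u n)"
  proof eventually_elim
    case (elim n)
    then have "a n = ennreal (q n)" by (simp add: q_def)
    with elim show ?case by (simp add: h_alpha_ennreal)
  qed
  \<comment> \<open>The base may tend to 0; the positive limit p of the exponents keeps the power
    continuous there.\<close>
  have "((\<lambda>n. max 0 (1 + u n / q n) powr q n) \<longlongrightarrow> max 0 (1 + u0 / p) powr p) F"
    using q u real by (intro tendsto_powr2 tendsto_intros) auto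
  then show ?thesis
    using real tendsto_cong[OF ev] by (simp add: h_alpha_ennreal)
next
  case top
  \<comment> \<open>The reciprocal index also covers \<open>a n = \<infinity>\<close>, where \<open>v n = 0\<close>.\<close>
  define v where "v n = enn2real (inverse (a n))" for n
  have "((\<lambda>n. inverse (a n)) \<longlongrightarrow> inverse \<alpha>) F"
    using a by (intro continuous_on_tendsto_compose[OF continuous_on_inverse_ennreal[OF continuous_on_id, of UNIV]]) auto
  then have "((\<lambda>n. inverse (a n)) \<longlongrightarrow> ennreal 0) F"
    using top by simp
  then have v: "(v \<longlongrightarrow> 0) F"
    unfolding v_def by (intro tendsto_enn2real) auto
  have uv: "((\<lambda>n. 1 + u n * v n) \<longlongrightarrow> 1) F"
    using tendsto_add[OF tendsto_const tendsto_mult[OF u v], of 1] by simp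
  have pos: "\<forall>\<^sub>F n in F. 0 < 1 + u n * v n"
    using uv by (intro order_tendstoD(1)) auto
  have a0: "\<forall>\<^sub>F n in F. 0 < a n"
    using a top by (intro order_tendstoD(1)) auto
  have lim: "((\<lambda>n. exp (u n / (1 + u n * v n))) \<longlongrightarrow> exp u0) F"
    using tendsto_exp[OF tendsto_divide[OF u uv]] by simp
  have lower: "\<forall>\<^sub>F n in F. exp (u n / (1 + u n * v n)) \<le> h_alpha (a n) (u n)"
    using pos a0
  proof eventually_elim
    case (elim n)
    show ?case
    proof (cases "a n" rule: h_alpha_cases)
      case zero
      with elim show ?thesis by simp
    next
      case top
      then show ?thesis by (simp add: v_def h_alpha_top)
    next
      case (real p)
      then have "v n = 1 / p" by (simp add: v_def inverse_ennreal field_simps)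
      with real elim exp_le_powr_one_plus[of p "u n"] show ?thesis
        by (simp add: h_alpha_ennreal)
    qed
  qed
  have upper: "\<forall>\<^sub>F n in F. h_alpha (a n) (u n) \<le> exp (u n)"
    using h_alpha_mono[of _ top] by (auto simp: h_alpha_top)
  show ?thesis
    using tendsto_sandwich[OF lower upper lim tendsto_exp[OF u]] top by (simp add: h_alpha_top)
qed

section \<open>Finiteness of the expectations\<close>

lemma X_alpha_measurable: "X \<in> X_alpha M a \<Longrightarrow> X \<in> borel_measurable M"
  by (simp add: X_alpha_def)

lemma (in prob_space) nn_integral_h_alpha_finite:
  assumes "X \<in> X_alpha M b" "b \<noteq> top" "0 < l"
  shows "(\<integral>\<^sup>+ \<omega>. ennreal (h_alpha b (l * (X \<omega> - x))) \<partial>M) < \<infinity>"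
proof (cases b rule: h_alpha_cases)
  case zero
  have "(\<integral>\<^sup>+ \<omega>. ennreal (h_alpha b (l * (X \<omega> - x))) \<partial>M) \<le> (\<integral>\<^sup>+ \<omega>. 1 \<partial>M)"
    using zero by (intro nn_integral_mono) (simp add: h_alpha_0)
  also have "\<dots> < \<infinity>"
    by (simp add: emeasure_space_1)
  finally show ?thesis .
next
  case top
  with assms show ?thesis by simp
next
  case (real p)
  have [measurable]: "X \<in> borel_measurable M"
    using assms(1) by (rule X_alpha_measurable)
  define A B where "A = 1 + l * \<bar>x\<bar> / p" and "B = l / p"
  have AB: "0 < A" "0 < B"
    using assms real by (auto simp: A_def B_def add_pos_nonneg)
  have bound: "h_alpha b (l * (y - x)) \<le> (2 * A) powr p + (2 * B) powr p * max 0 y powr p" for y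
  proof -
    have "l * (y - x) \<le> l * (max 0 y + \<bar>x\<bar>)"
      using assms by (intro mult_left_mono) auto
    then have "1 + l * (y - x) / p \<le> 1 + l * (max 0 y + \<bar>x\<bar>) / p"
      using real by (simp add: divide_right_mono)
    also have "\<dots> = A + B * max 0 y"
      by (simp add: A_def B_def distrib_left add_divide_distrib)
    \<comment> \<open>A sum is at most twice its larger term. Unlike convexity of the power, this
      also serves exponents p < 1.\<close>
    also have "\<dots> \<le> max (2 * A) (2 * B * max 0 y)"
      by linarith
    finally have "max 0 (1 + l * (y - x) / p) powr p \<le> max (2 * A) (2 * B * max 0 y) powr p"
      using AB real by (intro powr_mono2) auto
    also have "\<dots> \<le> (2 * A) powr p + (2 * B * max 0 y) powr p"
      by (auto simp: max_def)
    also have "(2 * B * max 0 y) powr p = (2 * B) powr p * max 0 y powr p"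
      using AB by (intro powr_mult)
    finally show ?thesis
      using real by (simp add: h_alpha_ennreal)
  qed
  have "(\<integral>\<^sup>+ \<omega>. ennreal (h_alpha b (l * (X \<omega> - x))) \<partial>M)
      \<le> (\<integral>\<^sup>+ \<omega>. ennreal ((2 * A) powr p) + ennreal ((2 * B) powr p) * ennreal (max 0 (X \<omega>) powr p) \<partial>M)"
    using bound by (intro nn_integral_mono) (simp flip: ennreal_plus ennreal_mult)
  also have "\<dots> = ennreal ((2 * A) powr p)
      + ennreal ((2 * B) powr p) * (\<integral>\<^sup>+ \<omega>. ennreal (max 0 (X \<omega>) powr p) \<partial>M)"
    by (simp add: nn_integral_add nn_integral_cmult emeasure_space_1)
  also have "\<dots> < \<infinity>"
    using assms(1) real by (simp add: X_alpha_def ennreal_mult_less_top)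
  finally show ?thesis .
qed

text \<open>Membership at index infinity provides a single good scale, hence the existential form.
  The shift by x only contributes the constant factor exp (- l * x).\<close>

lemma (in prob_space) nn_integral_h_alpha_finite_ex:
  assumes "X \<in> X_alpha M b"
  shows "\<exists>l>0. (\<integral>\<^sup>+ \<omega>. ennreal (h_alpha b (l * (X \<omega> - x))) \<partial>M) < \<infinity>"
proof (cases "b = top")
  case False
  then show ?thesis
    using nn_integral_h_alpha_finite[OF assms False zero_less_one] by (metis zero_less_one)
next
  case True
  have [measurable]: "X \<in> borel_measurable M"
    using assms by (rule X_alpha_measurable)
  from assms True obtain l where l: "l > 0" "(\<integral>\<^sup>+ \<omega>. ennreal (exp (l * X \<omega>)) \<partial>M) < \<infinity>"
    by (auto simp: X_alpha_def)
  have "(\<integral>\<^sup>+ \<omega>. ennreal (h_alpha b (l * (X \<omega> - x))) \<partial>M)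
      = (\<integral>\<^sup>+ \<omega>. ennreal (exp (- l * x)) * ennreal (exp (l * X \<omega>)) \<partial>M)"
    using True by (simp add: h_alpha_top algebra_simps flip: ennreal_mult exp_add)
  also have "\<dots> = ennreal (exp (- l * x)) * (\<integral>\<^sup>+ \<omega>. ennreal (exp (l * X \<omega>)) \<partial>M)"
    by (simp add: nn_integral_cmult)
  also have "\<dots> < \<infinity>"
    using l by (simp add: ennreal_mult_less_top)
  finally show ?thesis
    using l(1) by blast
qed

section \<open>Bounds for \<open>P_alpha\<close> from extreme scales, and Fatou's lemma\<close>

lemma P_alpha_le:
  assumes "0 < l"
  shows "P_alpha M a X x \<le> (\<integral>\<^sup>+ \<omega>. ennreal (h_alpha a (l * (X \<omega> - x))) \<partial>M)"
  unfolding P_alpha_def using assms by (intro INF_lower) auto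

lemma P_alpha_mono:
  assumes "a \<le> b"
  shows "P_alpha M a X x \<le> P_alpha M b X x"
  unfolding P_alpha_def
  using assms by (intro INF_mono) (blast intro: nn_integral_mono ennreal_leI h_alpha_mono)

text \<open>Fatou's lemma for moving scales, where no common dominating function is at hand.\<close>

lemma nn_integral_le_of_tendsto:
  fixes f :: "nat \<Rightarrow> 'a \<Rightarrow> ennreal"
  assumes "\<And>n. f n \<in> borel_measurable M" "\<And>\<omega>. (\<lambda>n. f n \<omega>) \<longlonglongrightarrow> g \<omega>"
    and "\<forall>\<^sub>F n in sequentially. (\<integral>\<^sup>+ \<omega>. f n \<omega> \<partial>M) \<le> c"
  shows "(\<integral>\<^sup>+ \<omega>. g \<omega> \<partial>M) \<le> c"
proof -
  have "g \<omega> = liminf (\<lambda>n. f n \<omega>)" for \<omega>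
    using lim_imp_Liminf[OF _ assms(2)] by simp
  then have "(\<integral>\<^sup>+ \<omega>. g \<omega> \<partial>M) = (\<integral>\<^sup>+ \<omega>. liminf (\<lambda>n. f n \<omega>) \<partial>M)"
    by simp
  also have "\<dots> \<le> liminf (\<lambda>n. \<integral>\<^sup>+ \<omega>. f n \<omega> \<partial>M)"
    by (rule nn_integral_liminf[OF assms(1)])
  also have "\<dots> \<le> c"
    using assms(3) by (intro Liminf_le) auto
  finally show ?thesis .
qed

text \<open>Along the scales l / (n + 1) the integrands tend to the value 1 at the origin, so the
  expectations, each at least \<open>P_alpha M a X x\<close>, tend to 1.\<close>

lemma (in prob_space) P_alpha_le_1:
  assumes [measurable]: "X \<in> borel_measurable M"
    and "a \<noteq> 0" "0 < l" and fin: "(\<integral>\<^sup>+ \<omega>. ennreal (h_alpha a (l * (X \<omega> - x))) \<partial>M) < \<infinity>"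
  shows "P_alpha M a X x \<le> 1"
proof -
  define s where "s n = l * inverse (real (Suc n))" for n
  have s: "s \<longlonglongrightarrow> 0"
    unfolding s_def using tendsto_mult[OF tendsto_const LIMSEQ_inverse_real_of_nat, of l] by simp
  have s0: "0 < s n" "s n \<le> l" for n
    using \<open>0 < l\<close> by (auto simp: s_def field_simps)
  \<comment> \<open>Shrinking the scale lowers the value for nonnegative y, and for negative y the
    value never exceeds 1.\<close>
  have bound: "h_alpha a (s n * y) \<le> 1 + h_alpha a (l * y)" for n y
  proof (cases "y \<ge> 0")
    case True
    then have "h_alpha a (s n * y) \<le> h_alpha a (l * y)"
      using s0 by (intro h_alpha_mono_arg mult_right_mono) auto
    then show ?thesis by simp
  next
    case False
    then have "h_alpha a (s n * y) \<le> h_alpha a 0"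
      using s0(1)[of n] by (intro h_alpha_mono_arg) (simp add: mult_nonneg_nonpos)
    then show ?thesis using h_alpha_nonneg[of a "l * y"] by simp
  qed
  have "(\<lambda>n. \<integral>\<^sup>+ \<omega>. ennreal (h_alpha a (s n * (X \<omega> - x))) \<partial>M) \<longlonglongrightarrow> (\<integral>\<^sup>+ \<omega>. ennreal 1 \<partial>M)"
  proof (rule nn_integral_dominated_convergence)
    show "(\<integral>\<^sup>+ \<omega>. 1 + ennreal (h_alpha a (l * (X \<omega> - x))) \<partial>M) < \<infinity>"
      using fin by (simp add: nn_integral_add emeasure_space_1)
    show "AE \<omega> in M. ennreal (h_alpha a (s n * (X \<omega> - x))) \<le> 1 + ennreal (h_alpha a (l * (X \<omega> - x)))" for n
      using bound by (simp add: h_alpha_nonneg flip: ennreal_1 ennreal_plus)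
    have "(\<lambda>n. h_alpha a (s n * y)) \<longlonglongrightarrow> h_alpha a 0" for y
      using tendsto_mult[OF s tendsto_const, of y] \<open>a \<noteq> 0\<close>
      by (intro h_alpha_tendsto[OF tendsto_const]) auto
    then show "AE \<omega> in M. (\<lambda>n. ennreal (h_alpha a (s n * (X \<omega> - x)))) \<longlonglongrightarrow> ennreal 1"
      by (intro AE_I2 tendsto_ennrealI) simp
  qed measurable
  then show ?thesis
    using s0 by (intro LIMSEQ_le_const) (auto simp: emeasure_space_1 intro!: P_alpha_le)
qed

text \<open>Exponentials dominate every \<open>h_alpha a\<close>. As X - x is almost surely
  nonpositive, exp ((n + 1) * (X - x)) is bounded by 1 and tends to the indicator of X = x.\<close>

lemma (in prob_space) P_alpha_le_of_AE_le:
  assumes [measurable]: "X \<in> borel_measurable M"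
    and neg: "AE \<omega> in M. X \<omega> \<le> x"
  shows "P_alpha M a X x \<le> (\<integral>\<^sup>+ \<omega>. indicator {x} (X \<omega>) \<partial>M)"
proof -
  have lim: "(\<lambda>n. exp (real (Suc n) * y)) \<longlonglongrightarrow> indicator {0} y" if "y \<le> 0" for y :: real
  proof (cases "y = 0")
    case False
    with that have "exp y < 1" by simp
    then have "(\<lambda>n. exp y ^ Suc n) \<longlonglongrightarrow> 0"
      by (intro LIMSEQ_Suc LIMSEQ_power_zero) simp
    then show ?thesis
      using False by (simp add: exp_of_nat_mult del: power_Suc of_nat_Suc)
  qed simp
  have "(\<lambda>n. \<integral>\<^sup>+ \<omega>. ennreal (exp (real (Suc n) * (X \<omega> - x))) \<partial>M)
      \<longlonglongrightarrow> (\<integral>\<^sup>+ \<omega>. ennreal (indicator {0} (X \<omega> - x)) \<partial>M)"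
  proof (rule nn_integral_dominated_convergence)
    show "(\<integral>\<^sup>+ \<omega>. 1 \<partial>M) < \<infinity>"
      by (simp add: emeasure_space_1)
    show "AE \<omega> in M. ennreal (exp (real (Suc n) * (X \<omega> - x))) \<le> 1" for n
      using neg by eventually_elim (simp add: mult_nonneg_nonpos)
    show "AE \<omega> in M. (\<lambda>n. ennreal (exp (real (Suc n) * (X \<omega> - x)))) \<longlonglongrightarrow> ennreal (indicator {0} (X \<omega> - x))"
      using neg by eventually_elim (intro tendsto_ennrealI lim, simp)
  qed measurable
  moreover have "P_alpha M a X x \<le> (\<integral>\<^sup>+ \<omega>. ennreal (exp (real (Suc n) * (X \<omega> - x))) \<partial>M)" for n
    using P_alpha_mono[of a top M X x] P_alpha_le[of "real (Suc n)" M top X x]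
    by (simp add: h_alpha_top)
  moreover have "(\<integral>\<^sup>+ \<omega>. ennreal (indicator {0} (X \<omega> - x)) \<partial>M) = (\<integral>\<^sup>+ \<omega>. indicator {x} (X \<omega>) \<partial>M)"
    by (intro nn_integral_cong) (simp add: indicator_def)
  ultimately show ?thesis
    by (intro LIMSEQ_le_const) auto
qed

section \<open>Lower bound along converging scales\<close>

lemma h_alpha_tendsto_at_top:
  assumes "0 < p" "filterlim u at_top F"
  shows "filterlim (\<lambda>n. h_alpha (ennreal p) (u n)) at_top F"
proof -
  have base: "filterlim (\<lambda>n. 1 + u n / p) at_top F"
    using assms by (intro filterlim_tendsto_add_at_top[OF tendsto_const])
      (simp add: divide_inverse filterlim_at_top_mult_tendsto_pos[OF tendsto_const])
  have "filterlim (\<lambda>n. exp (p * ln (1 + u n / p))) at_top F"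
    using assms by (intro filterlim_compose[OF exp_at_top]
      filterlim_tendsto_pos_mult_at_top[OF tendsto_const] filterlim_compose[OF ln_at_top base])
  moreover have "\<forall>\<^sub>F n in F. exp (p * ln (1 + u n / p)) = h_alpha (ennreal p) (u n)"
    using filterlim_at_top_dense[THEN iffD1, OF base, rule_format, of 0]
    by eventually_elim (use assms in \<open>simp add: h_alpha_ennreal powr_def\<close>)
  ultimately show ?thesis
    using filterlim_cong by fastforce
qed

lemma h_alpha_tendsto_at_bot:
  assumes "0 < p" "filterlim u at_bot F"
  shows "((\<lambda>n. h_alpha (ennreal p) (u n)) \<longlongrightarrow> 0) F"
proof (rule tendsto_eventually)
  have "\<forall>\<^sub>F n in F. u n < - p"
    using assms by (simp add: filterlim_at_bot_dense)
  then show "\<forall>\<^sub>F n in F. h_alpha (ennreal p) (u n) = 0"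
    by eventually_elim (use assms in \<open>simp add: h_alpha_ennreal field_simps max_def\<close>)
qed

text \<open>Taking the limit of the scales in \<open>ennreal\<close> treats vanishing, positive and
  diverging scales together. The finiteness assumption enters for vanishing scales, through
  \<open>P_alpha_le_1\<close>.\<close>

lemma (in prob_space) P_alpha_le_of_scales:
  fixes l :: "nat \<Rightarrow> real"
  assumes X [measurable]: "X \<in> borel_measurable M"
    and fin: "0 < l0" "(\<integral>\<^sup>+ \<omega>. ennreal (h_alpha \<alpha> (l0 * (X \<omega> - x))) \<partial>M) < \<infinity>"
    and "\<alpha> \<noteq> 0" and a: "a \<longlonglongrightarrow> \<alpha>"
    and l: "\<And>n. 0 < l n" "(\<lambda>n. ennreal (l n)) \<longlonglongrightarrow> L"
    and le: "\<And>n. (\<integral>\<^sup>+ \<omega>. ennreal (h_alpha (a n) (l n * (X \<omega> - x))) \<partial>M) \<le> c"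
  shows "P_alpha M \<alpha> X x \<le> c"
proof (cases "L = top")
  case False
  then obtain l' where L: "L = ennreal l'" "0 \<le> l'"
    by (cases L) auto
  have "l \<longlonglongrightarrow> l'"
    using l L by (intro tendsto_ennrealD[of l]) (auto simp: less_imp_le)
  then have "(\<lambda>n. h_alpha (a n) (l n * y)) \<longlonglongrightarrow> h_alpha \<alpha> (l' * y)" for y
    using \<open>\<alpha> \<noteq> 0\<close> by (intro h_alpha_tendsto[OF a] tendsto_mult tendsto_const)
  then have *: "(\<integral>\<^sup>+ \<omega>. ennreal (h_alpha \<alpha> (l' * (X \<omega> - x))) \<partial>M) \<le> c"
    using le by (intro nn_integral_le_of_tendsto[where f = "\<lambda>n \<omega>. ennreal (h_alpha (a n) (l n * (X \<omega> - x)))"]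
      tendsto_ennrealI) auto
  show ?thesis
  proof (cases "l' = 0")
    case True
    \<comment> \<open>Here the Fatou bound reads 1 \<le> c, since the limiting integrand is
      constantly 1.\<close>
    then show ?thesis
      using * P_alpha_le_1[OF X \<open>\<alpha> \<noteq> 0\<close> fin] by (simp add: emeasure_space_1)
  next
    case False
    then show ?thesis
      using * P_alpha_le[of l' M \<alpha> X x] L by (simp add: order.trans)
  qed
next
  case True
  have l_top: "filterlim l at_top sequentially"
    using l True by (simp add: ennreal_tendsto_top_eq_at_top)
  \<comment> \<open>Eventually p < a n, so monotonicity in the index replaces the moving function by
    the fixed \<open>h_alpha (ennreal p)\<close>. This covers finite and infinite \<alpha>
    alike.\<close>
  obtain p where p: "0 < p" "ennreal p < \<alpha>"
  proof -
    obtain e where e: "0 < e" "e < \<alpha>"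
      using dense[of 0 \<alpha>] \<open>\<alpha> \<noteq> 0\<close> by (auto simp: zero_less_iff_neq_zero)
    then show ?thesis
      using that by (cases e) auto
  qed
  \<comment> \<open>The pointwise limit of \<open>h_alpha (ennreal p)\<close> at l * y as l tends to
    infinity.\<close>
  define g :: "real \<Rightarrow> ennreal" where "g y = (if y > 0 then top else if y = 0 then 1 else 0)" for y
  have [measurable]: "g \<in> borel_measurable borel"
    unfolding g_def by measurable
  have lim: "(\<lambda>n. ennreal (h_alpha (ennreal p) (l n * y))) \<longlonglongrightarrow> g y" for y
  proof (cases y "0::real" rule: linorder_cases)
    case less
    have "filterlim (\<lambda>n. l n * y) at_bot sequentially"
      using filterlim_tendsto_neg_mult_at_bot[OF tendsto_const less l_top] by (simp add: mult.commute)
    then show ?thesis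
      using tendsto_ennrealI[OF h_alpha_tendsto_at_bot[OF p(1)]] less by (simp add: g_def)
  next
    case equal
    then show ?thesis by (simp add: g_def)
  next
    case greater
    have "filterlim (\<lambda>n. l n * y) at_top sequentially"
      using filterlim_tendsto_pos_mult_at_top[OF tendsto_const greater l_top] by (simp add: mult.commute)
    then show ?thesis
      using h_alpha_tendsto_at_top[OF p(1)] greater by (simp add: g_def ennreal_tendsto_top_eq_at_top)
  qed
  have "\<forall>\<^sub>F n in sequentially. ennreal p < a n"
    using a p by (intro order_tendstoD(1))
  then have "\<forall>\<^sub>F n in sequentially. (\<integral>\<^sup>+ \<omega>. ennreal (h_alpha (ennreal p) (l n * (X \<omega> - x))) \<partial>M) \<le> c"
  proof eventually_elim
    case (elim n)
    then have "(\<integral>\<^sup>+ \<omega>. ennreal (h_alpha (ennreal p) (l n * (X \<omega> - x))) \<partial>M)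
        \<le> (\<integral>\<^sup>+ \<omega>. ennreal (h_alpha (a n) (l n * (X \<omega> - x))) \<partial>M)"
      by (intro nn_integral_mono ennreal_leI h_alpha_mono) simp
    with le[of n] show ?case by simp
  qed
  then have g: "(\<integral>\<^sup>+ \<omega>. g (X \<omega> - x) \<partial>M) \<le> c"
    using lim by (intro nn_integral_le_of_tendsto) auto
  show ?thesis
  proof (cases "c = top")
    case False
    \<comment> \<open>Since g is infinite on the positive axis, a finite integral forces X \<le> x
      almost surely.\<close>
    with g have "(\<integral>\<^sup>+ \<omega>. g (X \<omega> - x) \<partial>M) \<noteq> \<infinity>"
      by (auto simp: top_unique)
    then have "AE \<omega> in M. g (X \<omega> - x) \<noteq> \<infinity>"
      by (intro nn_integral_noteq_infinite) auto
    then have neg: "AE \<omega> in M. X \<omega> \<le> x"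
      by eventually_elim (auto simp: g_def split: if_splits)
    have "(\<integral>\<^sup>+ \<omega>. indicator {x} (X \<omega>) \<partial>M) \<le> (\<integral>\<^sup>+ \<omega>. g (X \<omega> - x) \<partial>M)"
      by (intro nn_integral_mono) (simp add: g_def indicator_def)
    then show ?thesis
      using P_alpha_le_of_AE_le[OF X neg, of \<alpha>] g by (meson order.trans)
  qed simp
qed

section \<open>Convergence at a fixed scale\<close>

lemma h_alpha_tendsto_index:
  assumes a: "a \<longlonglongrightarrow> \<alpha>"
  shows "(\<lambda>n. h_alpha (a n) u) \<longlonglongrightarrow> h_alpha \<alpha> u"
proof (cases "\<alpha> = 0")
  case False
  then show ?thesis
    by (intro h_alpha_tendsto[OF a]) auto
next
  \<comment> \<open>With the argument fixed, the limit index 0 is allowed. For u \<ge> 0 the values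
    are squeezed between 1 and exp (2 * sqrt (u * q n)), which tends to 1; for u < 0 they vanish
    once q n < - u. The index 0 may itself occur in the sequence and is handled apart.\<close>
  case True
  define q where "q n = enn2real (a n)" for n
  have q: "q \<longlonglongrightarrow> 0"
    unfolding q_def using a True by (intro tendsto_enn2real) auto
  have "\<forall>\<^sub>F n in sequentially. a n < top"
    using a True by (intro order_tendstoD(2)[OF a]) auto
  then have aq: "\<forall>\<^sub>F n in sequentially. a n = ennreal (q n)"
    by eventually_elim (simp add: q_def)
  show ?thesis
  proof (cases "u < 0")
    case False
    have lower: "\<forall>\<^sub>F n in sequentially. 1 \<le> h_alpha (a n) u"
      using h_alpha_mono_arg[of 0 u] False by simp
    have upper: "\<forall>\<^sub>F n in sequentially. h_alpha (a n) u \<le> exp (2 * sqrt (u * q n))"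
      using aq
    proof eventually_elim
      case (elim n)
      show ?case
      proof (cases "q n = 0")
        case True
        then show ?thesis using elim by (simp add: h_alpha_0)
      next
        case q: False
        then have q_pos: "0 < q n" by (simp add: q_def less_le)
        \<comment> \<open>\<open>1 + t\<^sup>2 \<le> (1 + t)\<^sup>2 \<le> exp (2 * t)\<close>\<close>
        define t where "t = sqrt (u / q n)"
        have t: "0 \<le> t" "t\<^sup>2 = u / q n"
          using False q_pos by (auto simp: t_def)
        have "1 + u / q n \<le> (1 + t)\<^sup>2"
          using t by (simp add: power2_sum)
        also have "\<dots> \<le> (exp t)\<^sup>2"
          using t(1) by (intro power_mono exp_ge_add_one_self) auto
        also have "\<dots> = exp (2 * t)"
          by (simp flip: exp_of_nat_mult)
        finally have "(1 + u / q n) powr q n \<le> exp (2 * t) powr q n"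
          using False q_pos by (intro powr_mono2) (auto simp: add_nonneg_nonneg)
        also have "\<dots> = exp (2 * (t * q n))"
          by (simp add: powr_def mult_ac)
        also have "t * q n = sqrt (u * q n)"
          using q_pos by (simp add: t_def real_sqrt_divide real_sqrt_mult real_div_sqrt field_simps)
        finally show ?thesis
          using elim q_pos False by (simp add: h_alpha_ennreal)
      qed
    qed
    have "(\<lambda>n. exp (2 * sqrt (u * q n))) \<longlonglongrightarrow> exp (2 * sqrt (u * 0))"
      by (intro tendsto_intros q)
    then show ?thesis
      using tendsto_sandwich[OF lower upper tendsto_const] True False by (simp add: h_alpha_0)
  next
    case u: True
    have "\<forall>\<^sub>F n in sequentially. q n < - u"
      using q u by (intro order_tendstoD(2)) auto
    with aq have "\<forall>\<^sub>F n in sequentially. h_alpha (a n) u = 0"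
    proof eventually_elim
      case (elim n)
      show ?case
      proof (cases "q n = 0")
        case True
        then show ?thesis using elim u by (simp add: h_alpha_0)
      next
        case False
        then have "0 < q n" by (simp add: q_def less_le)
        then show ?thesis
          using elim by (simp add: h_alpha_ennreal field_simps max_def)
      qed
    qed
    then show ?thesis
      using True u by (simp add: h_alpha_0 tendsto_eventually)
  qed
qed

lemma (in prob_space) nn_integral_h_alpha_tendsto:
  assumes [measurable]: "X \<in> borel_measurable M"
    and a: "a \<longlonglongrightarrow> \<alpha>" "\<And>n. a n \<le> b"
    and fin: "(\<integral>\<^sup>+ \<omega>. ennreal (h_alpha b (l * (X \<omega> - x))) \<partial>M) < \<infinity>"
  shows "(\<lambda>n. \<integral>\<^sup>+ \<omega>. ennreal (h_alpha (a n) (l * (X \<omega> - x))) \<partial>M)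
    \<longlonglongrightarrow> (\<integral>\<^sup>+ \<omega>. ennreal (h_alpha \<alpha> (l * (X \<omega> - x))) \<partial>M)"
  by (rule nn_integral_dominated_convergence[OF _ _ _ _ fin])
    (use a in \<open>auto intro!: ennreal_leI h_alpha_mono tendsto_ennrealI h_alpha_tendsto_index\<close>)

text \<open>A convergent real sequence is bounded. Used contrapositively: an infinite supremum of
  finite indices forces an infinite limit.\<close>

lemma SUP_less_top_of_tendsto:
  fixes a :: "nat \<Rightarrow> ennreal"
  assumes "\<And>n. a n < top" "a \<longlonglongrightarrow> \<alpha>" "\<alpha> < top"
  shows "(SUP n. a n) < top"
proof -
  obtain r where "\<alpha> = ennreal r" "0 \<le> r"
    using assms(3) by (cases \<alpha>) auto
  then have "(\<lambda>n. enn2real (a n)) \<longlonglongrightarrow> r"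
    using assms by (intro tendsto_enn2real) auto
  then have "Bseq (\<lambda>n. enn2real (a n))"
    by (intro convergent_imp_Bseq convergentI)
  then obtain K where K: "\<And>n. \<bar>enn2real (a n)\<bar> \<le> K"
    by (auto simp: Bseq_def)
  have "a n \<le> ennreal K" for n
  proof -
    have "a n = ennreal (enn2real (a n))"
      using assms(1)[of n] by simp
    also have "\<dots> \<le> ennreal K"
      using K[of n] by (intro ennreal_leI) auto
    finally show ?thesis .
  qed
  then have "(SUP n. a n) \<le> ennreal K"
    by (intro SUP_least)
  then show ?thesis
    using ennreal_less_top le_less_trans by blast
qed

section \<open>The upper and lower bounds combined\<close>

theorem proposition1p4:
  fixes M :: "'a measure" and a :: "nat \<Rightarrow> ennreal" and \<alpha> \<beta> :: ennreal
    and X :: "'a \<Rightarrow> real"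
  assumes "prob_space M"
    and "\<And>n. a n < \<infinity>"
    and "a \<longlonglongrightarrow> \<alpha>"
    and "\<beta> = (SUP n. a n)"
    and "X \<in> X_alpha M \<beta>"
  shows "\<forall>x::real. (\<lambda>n. P_alpha M (a n) X x) \<longlonglongrightarrow> P_alpha M \<alpha> X x"
proof (intro allI order_tendstoI)
  interpret prob_space M by fact
  have X: "X \<in> borel_measurable M"
    using assms(5) by (rule X_alpha_measurable)
  have le_\<beta>: "a n \<le> \<beta>" for n
    unfolding assms(4) by (intro SUP_upper) simp
  have \<alpha>\<beta>: "\<alpha> \<le> \<beta>"
    using assms(3) le_\<beta> by (intro LIMSEQ_le_const2) auto
  fix x c
  {
    assume "P_alpha M \<alpha> X x < c"
    then obtain l where l: "0 < l" "(\<integral>\<^sup>+ \<omega>. ennreal (h_alpha \<alpha> (l * (X \<omega> - x))) \<partial>M) < c"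
      unfolding P_alpha_def by (auto simp: INF_less_iff)
    have "(\<integral>\<^sup>+ \<omega>. ennreal (h_alpha \<beta> (l * (X \<omega> - x))) \<partial>M) < \<infinity>"
    proof (cases "\<beta> = top")
      \<comment> \<open>Now \<alpha> is infinite too, so the chosen scale already has a finite
        expectation at index \<beta>, being below c. For finite \<beta> every scale does.\<close>
      case True
      then have "\<alpha> = \<beta>"
        using SUP_less_top_of_tendsto[OF _ assms(3)] assms(2,4) by (metis infinity_ennreal_def less_top)
      with l(2) show ?thesis
        using le_less_trans[OF _ less_le_trans[OF l(2) top_greatest]] by simp
    next
      case False
      then show ?thesis
        using assms(5) l(1) by (intro nn_integral_h_alpha_finite)
    qed
    from nn_integral_h_alpha_tendsto[OF X assms(3) le_\<beta> this] l(2)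
    have "\<forall>\<^sub>F n in sequentially. (\<integral>\<^sup>+ \<omega>. ennreal (h_alpha (a n) (l * (X \<omega> - x))) \<partial>M) < c"
      by (rule order_tendstoD(2))
    then show "\<forall>\<^sub>F n in sequentially. P_alpha M (a n) X x < c"
      by eventually_elim (rule le_less_trans[OF P_alpha_le[OF l(1)]])
  next
    assume c: "c < P_alpha M \<alpha> X x"
    show "\<forall>\<^sub>F n in sequentially. c < P_alpha M (a n) X x"
    proof (cases "\<alpha> = 0")
      case True
      then show ?thesis
        by (intro always_eventually allI less_le_trans[OF c] P_alpha_mono) simp
    next
      case False
      \<comment> \<open>An infimum at most c need not be attained; the gap up to d supplies scales
        with expectation below d.\<close>
      obtain d where d: "c < d" "d < P_alpha M \<alpha> X x"
        using dense[OF c] by blast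
      show ?thesis
      proof (rule ccontr)
        assume "\<not> ?thesis"
        then obtain r :: "nat \<Rightarrow> nat" where r: "strict_mono r" "\<And>n. \<not> c < P_alpha M (a (r n)) X x"
          using not_eventually_sequentiallyD by blast
        then have "P_alpha M (a (r n)) X x < d" for n
          using d(1) by (meson le_less_trans not_less)
        then have "\<forall>n. \<exists>l>0. (\<integral>\<^sup>+ \<omega>. ennreal (h_alpha (a (r n)) (l * (X \<omega> - x))) \<partial>M) < d"
          by (simp add: P_alpha_def INF_less_iff Bex_def greaterThan_iff)
        then obtain l where l: "\<And>n. 0 < l n"
          "\<And>n. (\<integral>\<^sup>+ \<omega>. ennreal (h_alpha (a (r n)) (l n * (X \<omega> - x))) \<partial>M) < d"
          by metis
        \<comment> \<open>Compactness of [0, infinity] gives a limit even when the scales are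
          unbounded. Composing \<open>r\<close> with \<open>s\<close> keeps the index sequence
          converging to \<alpha>.\<close>
        obtain L s where s: "strict_mono s" "((\<lambda>n. ennreal (l n)) \<circ> s) \<longlonglongrightarrow> L"
          using compact_complete_linorder[of "\<lambda>n. ennreal (l n)"] by blast
        obtain l0 where l0: "0 < l0" "(\<integral>\<^sup>+ \<omega>. ennreal (h_alpha \<beta> (l0 * (X \<omega> - x))) \<partial>M) < \<infinity>"
          using nn_integral_h_alpha_finite_ex[OF assms(5)] by blast
        have fin: "(\<integral>\<^sup>+ \<omega>. ennreal (h_alpha \<alpha> (l0 * (X \<omega> - x))) \<partial>M) < \<infinity>"
          using \<alpha>\<beta> by (intro le_less_trans[OF nn_integral_mono l0(2)] ennreal_leI h_alpha_mono)
        have "(a \<circ> (r \<circ> s)) \<longlonglongrightarrow> \<alpha>"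
          using assms(3) r(1) s(1) by (intro LIMSEQ_subseq_LIMSEQ strict_mono_o)
        then have "P_alpha M \<alpha> X x \<le> d"
          using s(2) l less_imp_le[OF l(2)]
          by (intro P_alpha_le_of_scales[OF X l0(1) fin False, of "a \<circ> (r \<circ> s)" "l \<circ> s" L])
            (auto simp: o_def)
        with d(2) show False by simp
      qed
    qed
  }
qed

end
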